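(* For every $n\in\mathbb{N}$, the morphism $\varrho_n\colon \mathsf{styl}_n\to U_{n+1}(\mathbb{T})$ induced by $\rho_n$ (see context) is a faithful representation of $\mathsf{styl}_n$, i.e. $\varrho_n$ is an injective monoid homomorphism.
   Context: $\mathbb{N}=\{1,2,3,\dots\}$ and $\mathcal{A}_n=\{1<2<\cdots<n\}$. $\mathcal{A}_n^*$ is the free monoid on $\mathcal{A}_n$, with empty word $\varepsilon$. The stylic monoid of rank $n$, $\mathsf{styl}_n$, is the monoid presented by generators $\mathcal{A}_n$ and relations $acb=cab$ (for $a\le b<c$), $bac=bca$ (for $a<b\le c$), and $a^2=a$ (for $a\in\mathcal{A}_n$); the class of $w\in \mathcal{A}_n^*$ is denoted $[w]_{\mathsf{styl}_n}$. The tropical semifield is $\mathbb{T}=(\mathbb{R}\cup\{-\infty\},\oplus,\otimes)$ with $a\oplus b=\max(a,b)$, $a\otimes b=a+b$, so its zero is $-\infty$ and its one is $0$. $U_{n+1}(\mathbb{T})$ is the monoid, under tropical matrix multiplication, of $(n+1)\times(n+1)$ upper unitriangular matrices over $\mathbb{T}$ (entries below the diagonal $-\infty$, diagonal entries $0$). For $x\in\mathcal{A}_n$ put $\overline{x}=n+1-x$. The monoid morphism $\rho_n\colon\mathcal{A}_n^*\to U_{n+1}(\mathbb{T})$ is defined on generators $x\in\mathcal{A}_n$ by $\rho_n(x)_{i,j}=0$ if $i=j$; $\rho_n(x)_{i,j}=1$ if $i\le\overline{x}<j$; $\rho_n(x)_{i,j}=-\infty$ otherwise. It factors through $\mathsf{styl}_n$,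 and $\varrho_n$ denotes the induced morphism, $\varrho_n([w]_{\mathsf{styl}_n})=\rho_n(w)$. *)

theory Defs
  imports "HOL-Algebra.Group" "Jordan_Normal_Form.Matrix"
begin

section \<open>The stylic monoid\<close>

text \<open>The free monoid on \<open>{1,\<dots>,n}\<close> is \<^term>\<open>lists {1..n::nat}\<close> under append.\<close>

definition stylic_relations :: "nat \<Rightarrow> (nat list \<times> nat list) set" where
  "stylic_relations n =
     {([a, c, b], [c, a, b]) | a b c. {a, b, c} \<subseteq> {1..n} \<and> a \<le> b \<and> b < c} \<union>
     {([b, a, c], [b, c, a]) | a b c. {a, b, c} \<subseteq> {1..n} \<and> a < b \<and> b \<le> c} \<union>
     {([a, a], [a]) | a. a \<in> {1..n}}"

inductive_set stylic_cong :: "nat \<Rightarrow> (nat list \<times> nat list) set" for n :: nat where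
  base: "(u, v) \<in> stylic_relations n \<Longrightarrow> (u, v) \<in> stylic_cong n"
| refl: "w \<in> lists {1..n} \<Longrightarrow> (w, w) \<in> stylic_cong n"
| sym: "(u, v) \<in> stylic_cong n \<Longrightarrow> (v, u) \<in> stylic_cong n"
| trans: "(u, v) \<in> stylic_cong n \<Longrightarrow> (v, w) \<in> stylic_cong n \<Longrightarrow> (u, w) \<in> stylic_cong n"
| append: "(u, v) \<in> stylic_cong n \<Longrightarrow> (u', v') \<in> stylic_cong n
             \<Longrightarrow> (u @ u', v @ v') \<in> stylic_cong n"

definition stylic_class :: "nat \<Rightarrow> nat list \<Rightarrow> nat list set" where
  "stylic_class n w = stylic_cong n `` {w}"

definition styl :: "nat \<Rightarrow> nat list set monoid" where
  "styl n = \<lparr>carrier = lists {1..n} // stylic_cong n,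
             mult = (\<lambda>C D. \<Union>u\<in>C. \<Union>v\<in>D. stylic_class n (u @ v)),
             one = stylic_class n []\<rparr>"

lemma stylic_cong_lists:
  assumes "(u, v) \<in> stylic_cong n"
  shows "u \<in> lists {1..n} \<and> v \<in> lists {1..n}"
  using assms by (induction rule: stylic_cong.induct) (auto simp: stylic_relations_def)

lemma equiv_stylic_cong: "equiv (lists {1..n}) (stylic_cong n)"
proof (rule equivI)
  show "stylic_cong n \<subseteq> lists {1..n} \<times> lists {1..n}"
    by (clarify, drule stylic_cong_lists, blast)
  show "refl_on (lists {1..n}) (stylic_cong n)"
    by (rule refl_onI) (rule stylic_cong.refl)
  show "sym (stylic_cong n)"
    by (rule symI) (rule stylic_cong.sym)
  show "trans (stylic_cong n)"
    by (rule transI) (rule stylic_cong.trans)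
qed

lemma carrier_styl: "carrier (styl n) = stylic_class n ` lists {1..n}"
  by (auto simp: styl_def stylic_class_def quotient_def)

lemma stylic_class_eq_iff:
  assumes "u \<in> lists {1..n}" "v \<in> lists {1..n}"
  shows "stylic_class n u = stylic_class n v \<longleftrightarrow> (u, v) \<in> stylic_cong n"
  unfolding stylic_class_def using eq_equiv_class_iff[OF equiv_stylic_cong assms] .

lemma mult_styl:
  assumes "u \<in> lists {1..n}" "v \<in> lists {1..n}"
  shows "stylic_class n u \<otimes>\<^bsub>styl n\<^esub> stylic_class n v = stylic_class n (u @ v)"
proof -
  have "stylic_class n (u' @ v') = stylic_class n (u @ v)"
    if "u' \<in> stylic_class n u" "v' \<in> stylic_class n v" for u' v'
  proof -
    have "(u, u') \<in> stylic_cong n" "(v, v') \<in> stylic_cong n"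
      using that by (auto simp: stylic_class_def)
    then have "(u @ v, u' @ v') \<in> stylic_cong n"
      by (rule stylic_cong.append)
    from equiv_class_eq[OF equiv_stylic_cong this] show ?thesis
      by (simp add: stylic_class_def)
  qed
  then have "(\<Union>u'\<in>stylic_class n u. \<Union>v'\<in>stylic_class n v. stylic_class n (u' @ v'))
      = (\<Union>u'\<in>stylic_class n u. \<Union>v'\<in>stylic_class n v. stylic_class n (u @ v))"
    by (intro SUP_cong HOL.refl)
  moreover have "u \<in> stylic_class n u" "v \<in> stylic_class n v"
    using assms by (simp_all only: stylic_class_def Image_singleton_iff stylic_cong.refl)
  then have "stylic_class n u \<noteq> {}" "stylic_class n v \<noteq> {}"
    by blast+
  ultimately show ?thesis
    by (simp add: styl_def)
qed

lemma monoid_styl: "monoid (styl n)"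
proof -
  have one: "\<one>\<^bsub>styl n\<^esub> = stylic_class n []"
    by (simp add: styl_def)
  show ?thesis
  proof (rule monoidI)
    fix x y assume "x \<in> carrier (styl n)" "y \<in> carrier (styl n)"
    then obtain u v where "x = stylic_class n u" "y = stylic_class n v"
      and uv: "u \<in> lists {1..n}" "v \<in> lists {1..n}"
      unfolding carrier_styl by blast
    then have "x \<otimes>\<^bsub>styl n\<^esub> y = stylic_class n (u @ v)"
      by (simp only: mult_styl)
    moreover have "u @ v \<in> lists {1..n}"
      using uv by simp
    ultimately show "x \<otimes>\<^bsub>styl n\<^esub> y \<in> carrier (styl n)"
      unfolding carrier_styl by (simp only: image_eqI)
  next
    show "\<one>\<^bsub>styl n\<^esub> \<in> carrier (styl n)"
      unfolding carrier_styl one by auto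
  next
    fix x y z
    assume "x \<in> carrier (styl n)" "y \<in> carrier (styl n)" "z \<in> carrier (styl n)"
    then obtain u v w where
      "x = stylic_class n u" "y = stylic_class n v" "z = stylic_class n w"
      "u \<in> lists {1..n}" "v \<in> lists {1..n}" "w \<in> lists {1..n}"
      unfolding carrier_styl by blast
    moreover from this have "u @ v \<in> lists {1..n}" "v @ w \<in> lists {1..n}" by simp_all
    ultimately show "x \<otimes>\<^bsub>styl n\<^esub> y \<otimes>\<^bsub>styl n\<^esub> z = x \<otimes>\<^bsub>styl n\<^esub> (y \<otimes>\<^bsub>styl n\<^esub> z)"
      by (simp only: mult_styl append_assoc)
  next
    fix x assume "x \<in> carrier (styl n)"
    then obtain u where u: "x = stylic_class n u" "u \<in> lists {1..n}"
      unfolding carrier_styl by blast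
    show "\<one>\<^bsub>styl n\<^esub> \<otimes>\<^bsub>styl n\<^esub> x = x" "x \<otimes>\<^bsub>styl n\<^esub> \<one>\<^bsub>styl n\<^esub> = x"
      using u mult_styl[of "[]" n u] mult_styl[of u n "[]"] by (simp_all add: one)
  qed
qed


section \<open>The tropical semifield\<close>

datatype tropical = MInf | Trop real

instantiation tropical :: comm_semiring_1
begin

definition zero_tropical :: tropical where "0 = MInf"

definition one_tropical :: tropical where "1 = Trop 0"

fun plus_tropical :: "tropical \<Rightarrow> tropical \<Rightarrow> tropical" where
  "MInf + y = y"
| "x + MInf = x"
| "Trop a + Trop b = Trop (max a b)"

fun times_tropical :: "tropical \<Rightarrow> tropical \<Rightarrow> tropical" where
  "MInf * y = MInf"
| "x * MInf = MInf"
| "Trop a * Trop b = Trop (a + b)"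

instance
proof
  fix a b c :: tropical
  show "a + b + c = a + (b + c)" by (cases a; cases b; cases c) auto
  show "a + b = b + a" by (cases a; cases b) auto
  show "0 + a = a" by (simp add: zero_tropical_def)
  show "a * b * c = a * (b * c)" by (cases a; cases b; cases c) auto
  show "a * b = b * a" by (cases a; cases b) auto
  show "1 * a = a" by (cases a) (auto simp: one_tropical_def)
  show "(a + b) * c = a * c + b * c" by (cases a; cases b; cases c) auto
  show "0 * a = 0" by (simp add: zero_tropical_def)
  show "a * 0 = 0" by (cases a) (auto simp: zero_tropical_def)
  show "(0::tropical) \<noteq> 1" by (simp add: zero_tropical_def one_tropical_def)
qed

end


section \<open>Tropical upper unitriangular matrices and the representation\<close>

definition tropical_unitriangular :: "nat \<Rightarrow> tropical mat monoid" where
  "tropical_unitriangular m =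
     \<lparr>carrier = {A \<in> carrier_mat m m. upper_triangular A \<and> (\<forall>i<m. A $$ (i, i) = 1)},
      mult = (*), one = 1\<^sub>m m\<rparr>"

lemma tropical_unitriangular_mult_closed:
  assumes "A \<in> carrier (tropical_unitriangular m)" "B \<in> carrier (tropical_unitriangular m)"
  shows "A * B \<in> carrier (tropical_unitriangular m)"
proof -
  have dims: "A \<in> carrier_mat m m" "B \<in> carrier_mat m m"
    and lower: "\<And>i j. j < i \<Longrightarrow> i < m \<Longrightarrow> A $$ (i, j) = 0" "\<And>i j. j < i \<Longrightarrow> i < m \<Longrightarrow> B $$ (i, j) = 0"
    and diag: "\<And>i. i < m \<Longrightarrow> A $$ (i, i) = 1" "\<And>i. i < m \<Longrightarrow> B $$ (i, i) = 1"
    using assms by (auto simp: tropical_unitriangular_def)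
  have entry: "(A * B) $$ (i, j) = (\<Sum>k\<in>{0..<m}. A $$ (i, k) * B $$ (k, j))"
    if "i < m" "j < m" for i j
    using dims that by (simp add: scalar_prod_def)
  have "(A * B) $$ (i, j) = 0" if "j < i" "i < m" for i j
  proof -
    have "A $$ (i, k) * B $$ (k, j) = 0" if "k < m" for k
      using lower(1)[of k i] lower(2)[of j k] \<open>j < i\<close> \<open>i < m\<close> that
      by (cases "k < i") auto
    then show ?thesis using entry[of i j] that by (simp add: sum.neutral)
  qed
  moreover have "(A * B) $$ (i, i) = 1" if "i < m" for i
  proof -
    have "A $$ (i, k) * B $$ (k, i) = (if k = i then 1 else 0)" if "k < m" for k
      using lower(1)[of k i] lower(2)[of i k] diag[of i] \<open>i < m\<close> that
      by (cases k i rule: linorder_cases) auto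
    then have "(A * B) $$ (i, i) = (\<Sum>k\<in>{0..<m}. if k = i then 1 else 0)"
      unfolding entry[OF that that] by (intro sum.cong) auto
    also have "\<dots> = 1" using that by simp
    finally show ?thesis .
  qed
  ultimately show ?thesis
    using dims by (auto simp: tropical_unitriangular_def)
qed

lemma monoid_tropical_unitriangular: "monoid (tropical_unitriangular m)"
proof (rule monoidI)
  fix A B
  assume "A \<in> carrier (tropical_unitriangular m)" "B \<in> carrier (tropical_unitriangular m)"
  then have "A * B \<in> carrier (tropical_unitriangular m)"
    by (rule tropical_unitriangular_mult_closed)
  then show "A \<otimes>\<^bsub>tropical_unitriangular m\<^esub> B \<in> carrier (tropical_unitriangular m)"
    by (simp add: tropical_unitriangular_def)
next
  show "\<one>\<^bsub>tropical_unitriangular m\<^esub> \<in> carrier (tropical_unitriangular m)"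
    by (auto simp: tropical_unitriangular_def)
qed (auto simp: tropical_unitriangular_def intro: assoc_mult_mat)

text \<open>Matrices are indexed from 0, so the entry at \<open>(i, j)\<close> below is the entry in row
  \<open>Suc i\<close> and column \<open>Suc j\<close> in the usual numbering; \<open>n + 1 - x\<close> is the
  image of the letter \<open>x\<close> under the order-reversing involution of \<open>{1,\<dots>,n}\<close>.\<close>

definition rho_gen :: "nat \<Rightarrow> nat \<Rightarrow> tropical mat" where
  "rho_gen n x = mat (n + 1) (n + 1) (\<lambda>(i, j).
     if i = j then Trop 0
     else if Suc i \<le> n + 1 - x \<and> n + 1 - x < Suc j then Trop 1
     else MInf)"

definition rho :: "nat \<Rightarrow> nat list \<Rightarrow> tropical mat" where
  "rho n w = foldr (\<lambda>x M. rho_gen n x * M) w (1\<^sub>m (n + 1))"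

text \<open>The map induced by \<^const>\<open>rho\<close> on congruence classes. \<^const>\<open>the_elem\<close> is meaningful
  only because \<^const>\<open>rho\<close> is constant on each class.\<close>

definition varrho :: "nat \<Rightarrow> nat list set \<Rightarrow> tropical mat" where
  "varrho n C = the_elem (rho n ` C)"

end

theory Submission
  imports Defs
begin

text \<open>The entries of \<open>\<rho>\<^sub>n(w)\<close> are the lengths of the longest strictly decreasing subsequences of
  \<open>w\<close> whose letters lie in a given interval, and these lengths respect the defining relations.
  Conversely, row insertion without deletion of the bumped letter shows that every word is congruent
  to the row reading \<open>R\<^sub>k \<dots> R\<^sub>1\<close> of a chain \<open>R\<^sub>1 \<supset> \<dots> \<supset> R\<^sub>k\<close> in which the minimum of \<open>R\<^sub>i\<close> is
  not in the next row. Let \<open>h(x)\<close> be the number of rows containing \<open>x\<close>. As the rows are nested, the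
  longest decreasing subsequence with letters in \<open>[a, b)\<close> is found greedily: scan the letters
  \<open>a, a + 1, \<dots>\<close> and increase a counter \<open>c\<close> at \<open>x\<close> whenever \<open>c < h(x)\<close>. The counter before \<open>b\<close>
  takes every value up to \<open>h(b) - 1\<close> when \<open>a\<close> varies, so that these lengths determine \<open>h\<close>.\<close>

section \<open>Longest decreasing subsequences\<close>

text \<open>The admissible letters are those of [\<open>lo\<close>, \<open>b\<close>). As
  \<open>b\<close> is excluded, taking \<open>x\<close> as first letter leaves the same problem with
  \<open>x\<close> as the new bound.\<close>

fun lds :: "nat \<Rightarrow> nat list \<Rightarrow> nat \<Rightarrow> nat" where
  "lds lo [] b = 0"
| "lds lo (x # w) b =
     (if lo \<le> x \<and> x < b then max (lds lo w b) (Suc (lds lo w x)) else lds lo w b)"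

lemma lds_mono: "b \<le> c \<Longrightarrow> lds lo w b \<le> lds lo w c"
proof (induction w arbitrary: b c)
  case (Cons x w)
  from Cons.IH[OF Cons.prems] Cons.prems show ?case by (auto simp: le_max_iff_disj)
qed simp

lemma lds_empty: "b \<le> lo \<Longrightarrow> lds lo w b = 0"
  by (induction w arbitrary: b) auto

lemma lds_append_cong:
  assumes "\<And>b. lds lo u b = lds lo v b"
  shows "lds lo (w @ u) b = lds lo (w @ v) b"
  using assms by (induction w arbitrary: b) auto

text \<open>In the first two relations only the pair \<open>z\<close>, \<open>x\<close> is
  decreasing on just one side. It can be exchanged for \<open>z\<close>, \<open>y\<close> or for
  \<open>y\<close>, \<open>x\<close> respectively, with the continuation in \<open>w\<close> kept.
  Equal letters never occur together in a strictly decreasing sequence.\<close>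

lemma lds_stylic_relations:
  assumes "(u, v) \<in> stylic_relations n"
  shows "lds lo (u @ w) b = lds lo (v @ w) b"
proof -
  consider (acb) x y z where "u = [x, z, y]" "v = [z, x, y]" "x \<le> y" "y < z"
    | (bac) x y z where "u = [y, x, z]" "v = [y, z, x]" "x < y" "y \<le> z"
    | (idem) x where "u = [x, x]" "v = [x]"
    using assms by (auto simp: stylic_relations_def)
  then show ?thesis
  proof cases
    case acb
    have "lds lo w x \<le> lds lo w y" "lds lo w y \<le> lds lo w z"
      "z < b \<Longrightarrow> lds lo w z \<le> lds lo w b"
      using acb by (simp_all add: lds_mono)
    then show ?thesis using acb by (auto simp: max_def)
  next
    case bac
    have "lds lo w x \<le> lds lo w y" "lds lo w y \<le> lds lo w z"
      "z < b \<Longrightarrow> lds lo w z \<le> lds lo w b"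
      using bac by (simp_all add: lds_mono)
    then show ?thesis using bac by (auto simp: max_def)
  next
    case idem
    then show ?thesis by auto
  qed
qed

text \<open>The suffix \<open>w\<close> makes the claim inductive: for a product, the left factor
  changes in front of a suffix, and the right factor changes behind a prefix, for all bounds at
  once.\<close>

lemma lds_stylic_cong:
  assumes "(u, v) \<in> stylic_cong n"
  shows "lds lo (u @ w) b = lds lo (v @ w) b"
  using assms
proof (induction arbitrary: w b rule: stylic_cong.induct)
  case (base u v)
  then show ?case by (rule lds_stylic_relations)
next
  case (append u v u' v')
  then show ?case using lds_append_cong[of lo "u' @ w" "v' @ w" v b] by simp
qed auto

section \<open>Entries of the representation\<close>

text \<open>In the tropical semifield \<open>g k + t = t\<close> means g(k) \<le> t, so a sum is an
  upper bound that is attained.\<close>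

lemma sum_eq_absorbing:
  fixes t :: "'b :: comm_monoid_add"
  assumes "finite A" "\<And>k. k \<in> A \<Longrightarrow> g k + t = t" "k0 \<in> A" "g k0 = t"
  shows "sum g A = t"
proof -
  have "sum g B + t = t" if "finite B" "B \<subseteq> A" for B
    using that by (induction B) (auto simp: assms(2) add.assoc)
  from this[of "A - {k0}"] assms show ?thesis
    by (simp add: sum.remove[OF assms(1,3)] add.commute)
qed

lemma rho_gen_carrier:
  "rho_gen n x \<in> carrier (tropical_unitriangular (n + 1))"
  by (auto simp: rho_gen_def tropical_unitriangular_def zero_tropical_def one_tropical_def)

lemma rho_carrier: "rho n w \<in> carrier (tropical_unitriangular (n + 1))"
proof (induction w)
  case Nil
  show ?case
    using monoid.one_closed[OF monoid_tropical_unitriangular, of "n + 1"]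
    by (simp add: rho_def tropical_unitriangular_def)
next
  case (Cons x w)
  then show ?case
    using tropical_unitriangular_mult_closed[OF rho_gen_carrier] by (simp add: rho_def)
qed

lemma rho_carrier_mat: "rho n w \<in> carrier_mat (n + 1) (n + 1)"
  using rho_carrier by (auto simp: tropical_unitriangular_def)

lemma rho_gen_carrier_mat: "rho_gen n x \<in> carrier_mat (n + 1) (n + 1)"
  by (simp add: rho_gen_def)

lemma rho_Cons: "rho n (x # w) = rho_gen n x * rho n w"
  by (simp add: rho_def)

lemma rho_append: "rho n (u @ v) = rho n u * rho n v"
proof (induction u)
  case Nil
  then show ?case using left_mult_one_mat[OF rho_carrier_mat] by (simp add: rho_def)
next
  case (Cons x u)
  then show ?case
    using assoc_mult_mat[OF rho_gen_carrier_mat rho_carrier_mat rho_carrier_mat]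
    by (simp add: rho_Cons)
qed

text \<open>With indices from 0, the letter \<open>x\<close> leads from \<open>i\<close> to
  \<open>j\<close> iff i < n + 1 - x \<le> j, that is, iff \<open>x\<close> lies in [n + 1 - j, n +
  1 - i). Off the diagonal at least one letter must be used, so length 0 becomes
  \<open>MInf\<close>.\<close>

definition lds_entry :: "nat \<Rightarrow> nat list \<Rightarrow> nat \<Rightarrow> nat \<Rightarrow> tropical" where
  "lds_entry n w i j =
     (if i = j then Trop 0
      else if lds (n + 1 - j) w (n + 1 - i) = 0 then MInf
      else Trop (real (lds (n + 1 - j) w (n + 1 - i))))"

lemma sum_lds_entry:
  assumes "y \<le> j" "j \<le> n"
  shows "(\<Sum>k\<in>{y..n}. lds_entry n w k j) = Trop (real (lds (n + 1 - j) w (n + 1 - y)))"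
proof (rule sum_eq_absorbing)
  let ?m = "lds (n + 1 - j) w (n + 1 - y)"
  \<comment> \<open>If \<open>?m\<close> is 0, all entries off the diagonal are \<open>MInf\<close>
    and the diagonal one supplies \<open>Trop 0\<close>; otherwise row \<open>y\<close> attains the
    maximum.\<close>
  let ?k = "if ?m = 0 then j else y"
  show "?k \<in> {y..n}" using assms by simp
  show "lds_entry n w ?k j = Trop (real ?m)"
    using lds_empty[of "n + 1 - j" "n + 1 - j" w] by (auto simp: lds_entry_def)
  fix k assume "k \<in> {y..n}"
  then have "lds (n + 1 - j) w (n + 1 - k) \<le> ?m" by (intro lds_mono) (simp add: diff_le_mono2)
  then show "lds_entry n w k j + Trop (real ?m) = Trop (real ?m)"
    by (simp add: lds_entry_def max_def)
qed simp

lemma rho_entry: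
  assumes "w \<in> lists {1..n}" "i \<le> n" "j \<le> n"
  shows "rho n w $$ (i, j) = lds_entry n w i j"
  using assms
proof (induction w arbitrary: i rule: list.induct)
  case Nil
  then show ?case
    by (auto simp: rho_def lds_entry_def one_tropical_def zero_tropical_def)
next
  case (Cons x w)
  let ?y = "n + 1 - x"
  have x: "1 \<le> x" "x \<le> n" and w: "w \<in> lists {1..n}" using Cons.prems by simp_all
  have IH: "rho n w $$ (k, j) = lds_entry n w k j" if "k \<le> n" for k
    using Cons.IH w that Cons.prems by blast
  have "rho n (x # w) $$ (i, j) = (\<Sum>k\<in>{0..n}. rho_gen n x $$ (i, k) * lds_entry n w k j)"
    using Cons.prems rho_carrier_mat[of n w] rho_gen_carrier_mat[of n x]
    by (auto simp: rho_Cons scalar_prod_def IH atLeastLessThanSuc_atLeastAtMost intro!: sum.cong)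
  \<comment> \<open>The identity part of \<open>rho_gen n x\<close> is the choice to skip
    \<open>x\<close>, the other part the choice to use it.\<close>
  also have "\<dots> = (\<Sum>k\<in>{0..n}. (if k = i then lds_entry n w k j else 0)
      + (if i < ?y \<and> ?y \<le> k then Trop 1 * lds_entry n w k j else 0))"
  proof (rule sum.cong)
    fix k assume "k \<in> {0..n}"
    moreover have "Trop 0 * t = t" "MInf * t = 0" for t
      by (cases t; simp add: zero_tropical_def)+
    ultimately show "rho_gen n x $$ (i, k) * lds_entry n w k j =
        (if k = i then lds_entry n w k j else 0)
        + (if i < ?y \<and> ?y \<le> k then Trop 1 * lds_entry n w k j else 0)"
      using Cons.prems(2) by (auto simp: rho_gen_def)
  qed simp
  also have "\<dots> = lds_entry n w i j
      + (\<Sum>k\<in>{0..n}. if i < ?y \<and> ?y \<le> k then Trop 1 * lds_entry n w k j else 0)"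
    using Cons.prems(2) by (simp add: sum.distrib)
  also have "(\<Sum>k\<in>{0..n}. if i < ?y \<and> ?y \<le> k then Trop 1 * lds_entry n w k j else 0)
      = (if i < ?y then Trop 1 * (\<Sum>k\<in>{?y..n}. lds_entry n w k j) else 0)"
    unfolding sum_distrib_left
    by (auto simp: sum.If_cases intro!: sum.cong)
  \<comment> \<open>Rows from \<open>?y\<close> on leave the bound \<open>n + 1 - ?y = x\<close> for
    the remaining letters. If \<open>?y\<close> exceeds \<open>j\<close>, these rows are below the
    diagonal.\<close>
  also have "(\<Sum>k\<in>{?y..n}. lds_entry n w k j)
      = (if ?y \<le> j then Trop (real (lds (n + 1 - j) w x)) else 0)"
  proof (cases "?y \<le> j")
    case True
    then show ?thesis using sum_lds_entry[OF True Cons.prems(3), of w] x by simp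
  next
    case False
    then have "lds_entry n w k j = 0" if "?y \<le> k" for k
      using that by (auto simp: lds_entry_def lds_empty zero_tropical_def diff_le_mono2)
    with False show ?thesis by (simp add: sum.neutral)
  qed
  also have "lds_entry n w i j + (if i < ?y then Trop 1 *
      (if ?y \<le> j then Trop (real (lds (n + 1 - j) w x)) else 0) else 0) = lds_entry n (x # w) i j"
  proof (cases "i < ?y \<and> ?y \<le> j")
    case True
    then have "n + 1 - j \<le> x" "x < n + 1 - i" "i \<noteq> j" using x by auto
    with True show ?thesis
      by (auto simp: lds_entry_def max_def)
  next
    case False
    then have "\<not> (n + 1 - j \<le> x \<and> x < n + 1 - i)" using x Cons.prems by auto
    with False show ?thesis
      by (auto simp: lds_entry_def zero_tropical_def)
  qed
  finally show ?case .
qed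

lemma rho_stylic_cong:
  assumes "(u, v) \<in> stylic_cong n"
  shows "rho n u = rho n v"
proof (rule eq_matI)
  have uv: "u \<in> lists {1..n}" "v \<in> lists {1..n}" using stylic_cong_lists[OF assms] by auto
  fix i j assume "i < dim_row (rho n v)" "j < dim_col (rho n v)"
  then have "i \<le> n" "j \<le> n" using rho_carrier_mat[of n v] by auto
  then show "rho n u $$ (i, j) = rho n v $$ (i, j)"
    using lds_stylic_cong[OF assms, of _ "[]"] uv by (simp add: rho_entry lds_entry_def)
qed (use rho_carrier_mat[of n u] rho_carrier_mat[of n v] in auto)

lemma rho_eq_imp_lds_eq:
  assumes "rho n u = rho n v" "u \<in> lists {1..n}" "v \<in> lists {1..n}" "1 \<le> lo" "b \<le> n + 1"
  shows "lds lo u b = lds lo v b"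
proof (cases "lo < b")
  case True
  \<comment> \<open>These indices invert the passage from matrix positions to intervals.\<close>
  let ?i = "n + 1 - b" and ?j = "n + 1 - lo"
  have "lds_entry n u ?i ?j = lds_entry n v ?i ?j"
    using rho_entry[of u n ?i ?j] rho_entry[of v n ?i ?j] assms True by simp
  moreover have "?i \<noteq> ?j" "n + 1 - ?j = lo" "n + 1 - ?i = b" using assms True by auto
  ultimately show ?thesis by (simp add: lds_entry_def split: if_splits)
qed (simp add: lds_empty)

lemma varrho_stylic_class:
  assumes "w \<in> lists {1..n}"
  shows "varrho n (stylic_class n w) = rho n w"
proof -
  have "w \<in> stylic_class n w"
    using stylic_cong.refl[OF assms] by (simp add: stylic_class_def)
  moreover have "rho n u = rho n w" if "u \<in> stylic_class n w" for u
    using that rho_stylic_cong by (auto simp: stylic_class_def)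
  ultimately have "rho n ` stylic_class n w = {rho n w}" by blast
  then show ?thesis by (simp add: varrho_def)
qed

section \<open>Tableaux\<close>

text \<open>Rows can be sets because a^2 = a removes repetitions; the head of the list is the
  largest row.\<close>

fun row_ins :: "nat \<Rightarrow> nat set list \<Rightarrow> nat set list" where
  "row_ins x [] = [{x}]"
| "row_ins x (R # Rs) =
     insert x R # (if \<exists>y\<in>R. x < y then row_ins (Min {y \<in> R. x < y}) Rs else Rs)"

fun row_word :: "nat set list \<Rightarrow> nat list" where
  "row_word [] = []"
| "row_word (R # Rs) = row_word Rs @ sorted_list_of_set R"

fun n_tableau :: "nat \<Rightarrow> nat set list \<Rightarrow> bool" where
  "n_tableau n [] = True"
| "n_tableau n (R # Rs) \<longleftrightarrow> R \<noteq> {} \<and> R \<subseteq> {1..n} \<and>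
     (\<forall>r\<in>\<Union>(set Rs). r \<in> R \<and> (\<exists>s\<in>R. s < r)) \<and> n_tableau n Rs"

lemma Min_greater:
  fixes R :: "nat set"
  assumes "finite R" "\<exists>y\<in>R. x < y"
  shows "Min {y \<in> R. x < y} \<in> R" "x < Min {y \<in> R. x < y}"
proof -
  have "Min {y \<in> R. x < y} \<in> {y \<in> R. x < y}" using assms by (intro Min_in) auto
  then show "Min {y \<in> R. x < y} \<in> R" "x < Min {y \<in> R. x < y}" by blast+
qed

lemma Union_row_ins:
  assumes "n_tableau n Rs"
  shows "\<Union>(set (row_ins x Rs)) \<subseteq> insert x (\<Union>(set Rs))"
  using assms
proof (induction Rs arbitrary: x)
  case (Cons R Rs)
  have fin: "finite R" using Cons.prems finite_subset by auto
  show ?case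
  proof (cases "\<exists>y\<in>R. x < y")
    case True
    then show ?thesis
      using Cons.IH[of "Min {y \<in> R. x < y}"] Cons.prems Min_greater[OF fin True] by auto
  qed auto
qed simp

text \<open>The bumped letter comes from \<open>R\<close>, so the rows stay nested, and
  \<open>x\<close> is a smaller letter of the new first row.\<close>

lemma n_tableau_row_ins:
  assumes "n_tableau n Rs" "x \<in> {1..n}"
  shows "n_tableau n (row_ins x Rs)"
  using assms
proof (induction Rs arbitrary: x)
  case (Cons R Rs)
  have fin: "finite R" using Cons.prems finite_subset by auto
  show ?case
  proof (cases "\<exists>y\<in>R. x < y")
    case True
    let ?y = "Min {y \<in> R. x < y}"
    note y = Min_greater[OF fin True]
    have "n_tableau n (row_ins ?y Rs)" using Cons y by auto
    moreover have "r \<in> insert x R \<and> (\<exists>s\<in>insert x R. s < r)"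
      if r: "r \<in> \<Union>(set (row_ins ?y Rs))" for r
    proof -
      have "r = ?y \<or> r \<in> \<Union>(set Rs)" using r Union_row_ins[of n Rs ?y] Cons.prems by auto
      then show ?thesis using Cons.prems y by auto
    qed
    ultimately show ?thesis using Cons.prems True by auto
  qed (use Cons.prems in auto)
qed auto

lemma row_word_lists: "n_tableau n Rs \<Longrightarrow> row_word Rs \<in> lists {1..n}"
proof (induction Rs)
  case (Cons R Rs)
  then have "finite R" using finite_subset by auto
  with Cons show ?case by auto
qed simp

section \<open>Every word is congruent to a tableau word\<close>

lemma stylic_cong_acb:
  "\<lbrakk>{x, y, z} \<subseteq> {1..n}; x \<le> y; y < z\<rbrakk> \<Longrightarrow> ([x, z, y], [z, x, y]) \<in> stylic_cong n"
  by (rule stylic_cong.base) (auto simp: stylic_relations_def)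

lemma stylic_cong_bac:
  "\<lbrakk>{x, y, z} \<subseteq> {1..n}; x < y; y \<le> z\<rbrakk> \<Longrightarrow> ([y, x, z], [y, z, x]) \<in> stylic_cong n"
  by (rule stylic_cong.base) (auto simp: stylic_relations_def)

lemma stylic_cong_idem: "x \<in> {1..n} \<Longrightarrow> ([x, x], [x]) \<in> stylic_cong n"
  by (rule stylic_cong.base) (auto simp: stylic_relations_def)

lemma stylic_cong_context:
  assumes "(u, v) \<in> stylic_cong n" "p \<in> lists {1..n}" "s \<in> lists {1..n}"
  shows "(p @ u @ s, p @ v @ s) \<in> stylic_cong n"
  using assms by (intro stylic_cong.append stylic_cong.refl)

text \<open>The letter \<open>x\<close> passes \<open>z\<close> by bca = bac, with the letter in
  front of \<open>z\<close> as b.\<close>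

lemma stylic_cong_move_left:
  assumes "sorted_wrt (<) (y # s)" "x < y" "{x, y} \<union> set s \<subseteq> {1..n}"
  shows "(y # s @ [x], y # x # s) \<in> stylic_cong n"
  using assms
proof (induction s arbitrary: y)
  case Nil
  then show ?case using stylic_cong.refl[of "[y, x]" n] by simp
next
  case (Cons z s)
  have "([y] @ (z # s @ [x]) @ [], [y] @ (z # x # s) @ []) \<in> stylic_cong n"
    using Cons.prems by (intro stylic_cong_context Cons.IH) auto
  moreover have "([] @ [y, z, x] @ s, [] @ [y, x, z] @ s) \<in> stylic_cong n"
    using Cons.prems by (intro stylic_cong_context stylic_cong.sym[OF stylic_cong_bac]) auto
  ultimately show ?case using stylic_cong.trans[of "y # z # s @ [x]"] by simp
qed

lemma stylic_cong_move_front: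
  assumes "sorted (p @ [x])" "x < y" "{x, y} \<union> set p \<subseteq> {1..n}"
  shows "(p @ [y, x], y # p @ [x]) \<in> stylic_cong n"
  using assms
proof (induction p)
  case Nil
  then show ?case using stylic_cong.refl[of "[y, x]" n] by simp
next
  case (Cons q p)
  \<comment> \<open>After the induction hypothesis \<open>r\<close> follows \<open>y\<close>, and it
    serves as b in acb = cab.\<close>
  obtain r t where rt: "p @ [x] = r # t" by (cases "p @ [x]") auto
  have "\<forall>z\<in>set (p @ [x]). q \<le> z \<and> z < y \<and> z \<in> {1..n}"
    using Cons.prems by (auto simp: sorted_append)
  then have r: "q \<le> r" "r < y" "r \<in> {1..n}" "set t \<subseteq> {1..n}"
    unfolding rt by auto
  have "([q] @ (p @ [y, x]) @ [], [q] @ (y # p @ [x]) @ []) \<in> stylic_cong n"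
    using Cons.prems by (intro stylic_cong_context Cons.IH) (auto simp: sorted_append)
  moreover have "([] @ [q, y, r] @ t, [] @ [y, q, r] @ t) \<in> stylic_cong n"
    using Cons.prems r by (intro stylic_cong_context stylic_cong_acb) auto
  ultimately show ?case using rt stylic_cong.trans[of "q # p @ [y, x]"] by simp
qed

text \<open>Move \<open>x\<close> left to \<open>y\<close>, duplicate \<open>y\<close>, and move the
  first copy to the front. The duplication is yx = yyx = yxy, by idempotence and bac = bca with b =
  c; it keeps the bumped letter in its row.\<close>

lemma stylic_cong_bump:
  assumes "sorted (p @ [x])" "sorted_wrt (<) (y # s)" "x < y" "{x, y} \<union> set p \<union> set s \<subseteq> {1..n}"
  shows "(p @ y # s @ [x], y # p @ x # y # s) \<in> stylic_cong n"
proof -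
  have lists: "p \<in> lists {1..n}" "s \<in> lists {1..n}" "x \<in> {1..n}" "y \<in> {1..n}"
    using assms(4) by auto
  have "(p @ (y # s @ [x]) @ [], p @ (y # x # s) @ []) \<in> stylic_cong n"
    using assms lists by (intro stylic_cong_context stylic_cong_move_left) auto
  moreover have "(p @ (y # x # s), p @ (y # x # y # s)) \<in> stylic_cong n"
  proof -
    have "([] @ [y, y] @ [x], [] @ [y] @ [x]) \<in> stylic_cong n"
      using lists by (intro stylic_cong_context stylic_cong_idem) auto
    moreover have "([y, x, y], [y, y, x]) \<in> stylic_cong n"
      using assms lists by (intro stylic_cong_bac) auto
    ultimately have "([y, x], [y, x, y]) \<in> stylic_cong n"
      using stylic_cong.sym[THEN stylic_cong.trans, of "[y, y, x]" "[y, x]" n "[y, x, y]"]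
        stylic_cong.sym by simp
    from stylic_cong_context[OF this lists(1,2)] show ?thesis by simp
  qed
  moreover have "([] @ (p @ [y, x]) @ (y # s), [] @ (y # p @ [x]) @ (y # s)) \<in> stylic_cong n"
    using assms lists by (intro stylic_cong_context stylic_cong_move_front) auto
  ultimately show ?thesis
    using stylic_cong.trans[of "p @ y # s @ [x]"] stylic_cong.trans[of "p @ y # x # s"] by simp
qed

lemma sorted_list_of_set_split:
  fixes R :: "nat set"
  assumes "finite R"
  shows "sorted_list_of_set R =
    sorted_list_of_set {y \<in> R. y < x} @ sorted_list_of_set (R \<inter> {x}) @
    sorted_list_of_set {y \<in> R. x < y}"
proof (rule sorted_distinct_set_unique)
  show "sorted (sorted_list_of_set {y \<in> R. y < x} @ sorted_list_of_set (R \<inter> {x}) @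
    sorted_list_of_set {y \<in> R. x < y})"
    using assms by (auto simp: sorted_append)
qed (use assms in auto)

lemma stylic_cong_absorb:
  assumes "x \<in> {1..n}" "p \<in> lists {1..n}" "s \<in> lists {1..n}"
  shows "(p @ sorted_list_of_set (R \<inter> {x}) @ x # s, p @ x # s) \<in> stylic_cong n"
proof (cases "x \<in> R")
  case True
  then show ?thesis
    using stylic_cong_context[OF stylic_cong_idem[OF assms(1)] assms(2,3)] by simp
next
  case False
  have "p @ x # s \<in> lists {1..n}" using assms by simp
  with False show ?thesis by (simp add: stylic_cong.refl)
qed

lemma stylic_cong_row_ins:
  assumes "n_tableau n Rs" "x \<in> {1..n}"
  shows "(row_word Rs @ [x], row_word (row_ins x Rs)) \<in> stylic_cong n"
  using assms
proof (induction Rs arbitrary: x)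
  case Nil
  then show ?case by (auto intro: stylic_cong.refl)
next
  case (Cons R Rs)
  have R: "R \<subseteq> {1..n}" and Rs: "n_tableau n Rs" using Cons.prems by auto
  have fin: "finite R" using R finite_subset by auto
  define p where "p = sorted_list_of_set {y \<in> R. y < x}"
  define q where "q = sorted_list_of_set (R \<inter> {x})"
  define s where "s = sorted_list_of_set {y \<in> R. x < y}"
  have split: "sorted_list_of_set R = p @ q @ s"
    using sorted_list_of_set_split[OF fin, of x] by (simp add: p_def q_def s_def)
  have "{y \<in> insert x R. y < x} = {y \<in> R. y < x}" "{y \<in> insert x R. x < y} = {y \<in> R. x < y}"
    by auto
  then have split': "sorted_list_of_set (insert x R) = p @ x # s"
    using sorted_list_of_set_split[of "insert x R" x] fin by (simp add: p_def s_def)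
  have lists: "p \<in> lists {1..n}" "q \<in> lists {1..n}" "s \<in> lists {1..n}"
    using R Cons.prems(2) fin by (auto simp: p_def q_def s_def)
  have W: "row_word Rs \<in> lists {1..n}" using Rs by (rule row_word_lists)
  have drop: "(p @ q @ x # s, p @ x # s) \<in> stylic_cong n"
    unfolding q_def using Cons.prems(2) lists by (intro stylic_cong_absorb) auto
  show ?case
  proof (cases "\<exists>y\<in>R. x < y")
    case False
    then have "{y \<in> R. x < y} = {}" by auto
    then have "s = []" unfolding s_def by (simp only: sorted_list_of_set_empty)
    then show ?thesis
      using stylic_cong_context[OF drop W, of "[]"] False split split' by simp
  next
    case True
    define y where "y = Min {y \<in> R. x < y}"
    note y = Min_greater[OF fin True, folded y_def]
    define s' where "s' = sorted_list_of_set ({y \<in> R. x < y} - {y})"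
    have s: "s = y # s'"
      unfolding s_def s'_def y_def using fin True by (intro sorted_list_of_set_nonempty) auto
    \<comment> \<open>Here \<open>q\<close> is empty or \<open>[x]\<close>, so this word is only
      weakly increasing; the extra \<open>x\<close> is absorbed later by
      \<open>drop\<close>.\<close>
    have sorted: "sorted ((p @ q) @ [x])"
      using fin by (auto simp: p_def q_def sorted_append intro: less_imp_le)
    have "sorted_wrt (<) (y # s')" unfolding s[symmetric] s_def by simp
    then have "((p @ q) @ y # s' @ [x], y # (p @ q) @ x # y # s') \<in> stylic_cong n"
      using sorted y lists Cons.prems(2) s by (intro stylic_cong_bump) auto
    then have "(sorted_list_of_set R @ [x], [y] @ (p @ q @ x # s) @ []) \<in> stylic_cong n"
      using split s by simp
    moreover have "([y] @ (p @ q @ x # s) @ [], [y] @ (p @ x # s) @ []) \<in> stylic_cong n"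
      using y R by (intro stylic_cong_context drop) auto
    ultimately have "(sorted_list_of_set R @ [x], [y] @ sorted_list_of_set (insert x R))
        \<in> stylic_cong n"
      unfolding split' append_Nil2 by (rule stylic_cong.trans)
    \<comment> \<open>The bumped letter now stands directly after the word of the later rows, ready
      to be inserted there.\<close>
    from stylic_cong_context[OF this W, of "[]"]
    have "(row_word Rs @ sorted_list_of_set R @ [x],
        (row_word Rs @ [y]) @ sorted_list_of_set (insert x R)) \<in> stylic_cong n" by simp
    moreover have "((row_word Rs @ [y]) @ sorted_list_of_set (insert x R),
        row_word (row_ins y Rs) @ sorted_list_of_set (insert x R)) \<in> stylic_cong n"
    proof (rule stylic_cong.append)
      show "(row_word Rs @ [y], row_word (row_ins y Rs)) \<in> stylic_cong n"
        using Rs y R by (intro Cons.IH) auto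
      show "(sorted_list_of_set (insert x R), sorted_list_of_set (insert x R)) \<in> stylic_cong n"
        using R Cons.prems(2) fin by (intro stylic_cong.refl)
        (auto simp del: sorted_list_of_set_insert_remove)
    qed
    ultimately show ?thesis
      unfolding row_word.simps row_ins.simps y_def[symmetric] if_P[OF True] append_assoc
      by (rule stylic_cong.trans)
  qed
qed

lemma ex_n_tableau_stylic_cong:
  assumes "w \<in> lists {1..n}"
  obtains Rs where "n_tableau n Rs" "(w, row_word Rs) \<in> stylic_cong n"
proof -
  have "\<exists>Rs. n_tableau n Rs \<and> (w, row_word Rs) \<in> stylic_cong n"
    using assms
  proof (induction w rule: rev_induct)
    case Nil
    have "n_tableau n [] \<and> ([], row_word []) \<in> stylic_cong n"
      by (auto intro: stylic_cong.refl)
    then show ?case by blast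
  next
    case (snoc x w)
    then obtain Rs where Rs: "n_tableau n Rs" "(w, row_word Rs) \<in> stylic_cong n" by auto
    have x: "x \<in> {1..n}" using snoc.prems by simp
    have "(w @ [x], row_word Rs @ [x]) \<in> stylic_cong n"
      using Rs x by (auto intro!: stylic_cong.append stylic_cong.refl)
    then have "(w @ [x], row_word (row_ins x Rs)) \<in> stylic_cong n"
      using stylic_cong_row_ins[OF Rs(1) x] by (rule stylic_cong.trans)
    then show ?case using n_tableau_row_ins[OF Rs(1) x] by blast
  qed
  then show ?thesis using that by blast
qed

section \<open>Heights\<close>

text \<open>The count stops at the first row without \<open>x\<close>; on nested rows this is the
  number of rows containing \<open>x\<close>.\<close>

fun height :: "nat set list \<Rightarrow> nat \<Rightarrow> nat" where
  "height [] x = 0"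
| "height (R # Rs) x = (if x \<in> R then Suc (height Rs x) else 0)"

fun greedy :: "(nat \<Rightarrow> nat) \<Rightarrow> nat \<Rightarrow> nat \<Rightarrow> nat" where
  "greedy h lo 0 = 0"
| "greedy h lo (Suc b) =
     (if lo \<le> b \<and> greedy h lo b < h b then Suc (greedy h lo b) else greedy h lo b)"

lemma height_le_length: "height Rs x \<le> length Rs"
  by (induction Rs) auto

lemma height_eq_0: "x \<notin> \<Union>(set Rs) \<Longrightarrow> height Rs x = 0"
  by (cases Rs) auto

lemma mem_nth_iff_height:
  assumes "n_tableau n Rs" "j < length Rs"
  shows "x \<in> Rs ! j \<longleftrightarrow> j < height Rs x"
  using assms
proof (induction Rs arbitrary: j)
  case (Cons R Rs)
  show ?case
  proof (cases j)
    case (Suc i)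
    then have i: "i < length Rs" using Cons.prems by simp
    with Cons.prems have "x \<in> R" if "x \<in> Rs ! i" using that nth_mem[OF i] by auto
    with Cons.IH[OF _ i] Cons.prems Suc show ?thesis by auto
  qed auto
qed simp

text \<open>Heights cannot see empty rows, and a tableau has none.\<close>

lemma n_tableau_eqI:
  assumes "n_tableau n Rs" "n_tableau n Ss" "\<And>x. height Rs x = height Ss x"
  shows "Rs = Ss"
  using assms
proof (induction Rs arbitrary: Ss)
  case Nil
  show ?case
  proof (cases Ss)
    case (Cons S Ss')
    with Nil obtain x where "x \<in> S" by auto
    with Nil(3)[of x] Cons show ?thesis by simp
  qed simp
next
  case (Cons R Rs)
  then obtain x where "x \<in> R" by auto
  with Cons.prems(3)[of x] obtain S Ss' where Ss: "Ss = S # Ss'" by (cases Ss) auto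
  have mem: "x \<in> R \<longleftrightarrow> x \<in> S" for x
    using Cons.prems(3)[of x] Ss by (auto split: if_splits)
  have "height Rs x = height Ss' x" for x
  proof (cases "x \<in> R")
    case True
    then show ?thesis using Cons.prems(3)[of x] Ss mem by simp
  next
    \<comment> \<open>Outside \<open>R\<close> the given heights say nothing about later rows;
      nesting does.\<close>
    case False
    then have "x \<notin> \<Union>(set Rs)" "x \<notin> \<Union>(set Ss')"
      using Cons.prems Ss mem by auto
    then show ?thesis by (simp add: height_eq_0)
  qed
  then have "Rs = Ss'" using Cons.IH[of Ss'] Cons.prems Ss by simp
  with Ss mem show ?case by auto
qed

text \<open>A letter of a later row is not the minimum of the row before it, so that row contains a
  smaller letter.\<close>

lemma height_restricted_growth:
  assumes "n_tableau n Rs" "Suc j < height Rs x"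
  shows "\<exists>s<x. j < height Rs s"
  using assms
proof (induction Rs arbitrary: j)
  case (Cons R Rs)
  then have j: "j < height Rs x" by (auto split: if_splits)
  then have "x \<in> \<Union>(set Rs)" using height_eq_0 by fastforce
  show ?case
  proof (cases j)
    case 0
    from \<open>x \<in> \<Union>(set Rs)\<close> obtain s where "s \<in> R" "s < x"
      using Cons.prems(1) by (meson n_tableau.simps(2))
    with 0 show ?thesis by auto
  next
    case (Suc i)
    then obtain s where s: "s < x" "i < height Rs s" using Cons.IH[of i] Cons.prems j by auto
    then have "s \<in> R" using height_eq_0[of s Rs] Cons.prems by fastforce
    with s Suc show ?thesis by auto
  qed
qed simp

section \<open>The greedy counter and tableau words\<close>

lemma greedy_mono: "b \<le> c \<Longrightarrow> greedy h lo b \<le> greedy h lo c"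
  by (rule lift_Suc_mono_le[of "greedy h lo"]) auto

lemma greedy_empty: "b \<le> lo \<Longrightarrow> greedy h lo b = 0"
  by (induction b) auto

lemma greedy_le:
  assumes "\<And>x. h x \<le> k"
  shows "greedy h lo b \<le> k"
proof (induction b)
  case (Suc b)
  with assms[of b] show ?case by auto
qed simp

text \<open>Equal counters move together from then on. A counter ahead by one advances only when the
  other does, since c + 1 < h(b) implies c < h(b).\<close>

lemma greedy_Suc_lo:
  "greedy h (Suc lo) b \<le> greedy h lo b \<and> greedy h lo b \<le> Suc (greedy h (Suc lo) b)"
proof (induction b)
  case (Suc b)
  show ?case
  proof (cases "b \<le> lo")
    case True
    then show ?thesis by (auto simp: greedy_empty)
  qed (use Suc in auto)
qed simp

text \<open>A decreasing subsequence uses at most one letter of the increasing word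
  \<open>xs\<close>. When the bound grows by one, the new candidates lie in \<open>w\<close> or
  start with \<open>b\<close> in \<open>xs\<close>.\<close>

lemma lds_row_append:
  assumes "sorted_wrt (<) xs"
  shows "lds lo (xs @ w) (Suc b) =
    max (max (lds lo (xs @ w) b) (lds lo w (Suc b)))
      (if b \<in> set xs \<and> lo \<le> b then Suc (lds lo w b) else 0)"
  using assms
proof (induction xs)
  case Nil
  then show ?case using lds_mono[of b "Suc b" lo w] by simp
next
  case (Cons x xs)
  have skip: "lds lo (ys @ w) x = lds lo w x" if "\<forall>y\<in>set ys. x < y" for ys
    using that by (induction ys) auto
  have *: "lds lo (xs @ w) x = lds lo w x" using skip[of xs] Cons.prems by auto
  have "b \<notin> set xs" if "x = b" using that Cons.prems by auto
  with * Cons show ?case by (auto simp: max_def)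
qed

text \<open>The \<open>Suc k\<close>-th row consists of the letters of height at least \<open>Suc k\<close>, so putting it in front
  raises the bound on the counter from \<open>k\<close> to \<open>Suc k\<close>.\<close>

lemma lds_row_word_take:
  assumes "n_tableau n Rs" "k \<le> length Rs"
  shows "lds lo (row_word (take k Rs)) b = min k (greedy (height Rs) lo b)"
  using assms(2)
proof (induction k arbitrary: b)
  case (Suc k)
  let ?Q = "sorted_list_of_set (Rs ! k)"
  let ?w = "row_word (take k Rs)"
  let ?c = "greedy (height Rs) lo"
  have k: "k < length Rs" using Suc.prems by simp
  have snoc: "row_word (Ss @ [Q]) = sorted_list_of_set Q @ row_word Ss" for Ss Q
    by (induction Ss) auto
  have word: "row_word (take (Suc k) Rs) = ?Q @ ?w"
    using k by (simp add: take_Suc_conv_app_nth snoc)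
  have "finite (Rs ! k)"
    using assms(1) k
  proof (induction Rs arbitrary: k)
    case (Cons R Rs)
    then show ?case by (cases k) (auto intro: finite_subset)
  qed simp
  then have mem: "x \<in> set ?Q \<longleftrightarrow> k < height Rs x" for x
    using mem_nth_iff_height[OF assms(1) k] by simp
  have IH: "lds lo ?w b = min k (?c b)" for b using Suc by simp
  have "lds lo (?Q @ ?w) b = min (Suc k) (?c b)"
  proof (induction b)
    case 0
    then show ?case by (simp add: lds_empty)
  next
    case (Suc b)
    have "lds lo (?Q @ ?w) (Suc b) =
      max (max (min (Suc k) (?c b)) (min k (?c (Suc b))))
        (if k < height Rs b \<and> lo \<le> b then Suc (min k (?c b)) else 0)"
      unfolding lds_row_append[OF strict_sorted_list_of_set] Suc IH mem ..
    \<comment> \<open>If the counter moves at \<open>b\<close> but \<open>b\<close> is not in the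
      new row, then the counter is below h(b) \<le> k, so the term with \<open>min k\<close> already
      has the right value.\<close>
    also have "\<dots> = min (Suc k) (?c (Suc b))"
      by (cases "lo \<le> b"; cases "?c b < height Rs b"; cases "k < height Rs b") simp_all
    finally show ?case .
  qed
  then show ?case by (simp only: word)
qed simp

lemma lds_row_word:
  assumes "n_tableau n Rs"
  shows "lds lo (row_word Rs) b = greedy (height Rs) lo b"
  using lds_row_word_take[OF assms, of "length Rs" lo b] greedy_le[of "height Rs", OF height_le_length]
  by simp

text \<open>Restricted growth yields s < x whose height is at least that of \<open>x\<close> minus
  one; by induction the counter reaches the height of s once s is scanned.\<close>

lemma height_le_Suc_greedy:
  assumes "n_tableau n Rs"
  shows "height Rs x \<le> Suc (greedy (height Rs) 1 x)"
proof (induction x rule: less_induct)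
  case (less x)
  let ?c = "greedy (height Rs) 1"
  show ?case
  proof (cases "height Rs x \<le> 1")
    case False
    then obtain j where j: "height Rs x = Suc (Suc j)"
      by (cases "height Rs x") (auto simp: not_le gr0_conv_Suc)
    then obtain s where s: "s < x" "j < height Rs s"
      using height_restricted_growth[OF assms, of j x] by auto
    have "0 \<notin> \<Union>(set Ss)" if "n_tableau n Ss" for Ss
      using that by (induction Ss) auto
    then have "height Rs 0 = 0" using assms by (simp add: height_eq_0)
    with s(2) have "1 \<le> s" by (cases s) auto
    \<comment> \<open>The counter before \<open>s\<close> is at least the height of
      \<open>s\<close>, or one short of it and then advances at \<open>s\<close>, which is scanned
      as 1 \<le> s.\<close>
    with less.IH[OF s(1)] have "height Rs s \<le> ?c (Suc s)" by auto
    also have "\<dots> \<le> ?c x" using s(1) by (intro greedy_mono) simp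
    finally show ?thesis using j s(2) by simp
  qed simp
qed

text \<open>A discrete intermediate value argument: the counter is 0 at lo = b and changes by at
  most one as \<open>lo\<close> decreases to 1.\<close>

lemma ex_greedy_eq:
  assumes "v \<le> greedy h 1 b" "1 \<le> b"
  shows "\<exists>lo\<in>{1..b}. greedy h lo b = v"
proof -
  have "\<exists>lo\<in>{1..b}. greedy h lo b = v" if "v \<le> greedy h m b" "1 \<le> m" "m \<le> b" for m
    using that(3,1,2)
  proof (induction m rule: inc_induct)
    case base
    then show ?case using assms(2) by (intro bexI[of _ b]) (auto simp: greedy_empty)
  next
    case (step m)
    then show ?case using greedy_Suc_lo[of h m b] by (cases "greedy h m b = v") auto
  qed
  then show ?thesis using assms by blast
qed

text \<open>If \<open>x\<close> were higher in \<open>Rs\<close>, start so that the counter before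
  \<open>x\<close> equals its height in \<open>Ss\<close>. At \<open>x\<close> the counter of
  \<open>Ss\<close> then stalls while that of \<open>Rs\<close> advances.\<close>

lemma height_le_of_greedy_eq:
  assumes "n_tableau n Rs" "n_tableau n Ss" "1 \<le> x"
    and "\<And>lo b. 1 \<le> lo \<Longrightarrow> b \<le> Suc x \<Longrightarrow> greedy (height Rs) lo b = greedy (height Ss) lo b"
  shows "height Rs x \<le> height Ss x"
proof (rule ccontr)
  assume less: "\<not> height Rs x \<le> height Ss x"
  with height_le_Suc_greedy[OF assms(1), of x]
  have "height Ss x \<le> greedy (height Rs) 1 x" by simp
  then obtain lo where lo: "lo \<in> {1..x}" "greedy (height Rs) lo x = height Ss x"
    using ex_greedy_eq assms(3) by blast
  then have "greedy (height Ss) lo x = height Ss x" using assms(4)[of lo x] by simp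
  with lo less show False using assms(4)[of lo "Suc x"] by simp
qed

section \<open>Injectivity\<close>

lemma row_word_eqI:
  assumes "n_tableau n Rs" "n_tableau n Ss" "rho n (row_word Rs) = rho n (row_word Ss)"
  shows "Rs = Ss"
proof (rule n_tableau_eqI[OF assms(1,2)])
  fix x
  have eq: "greedy (height Rs) lo b = greedy (height Ss) lo b" if "1 \<le> lo" "b \<le> n + 1" for lo b
    using rho_eq_imp_lds_eq[OF assms(3) row_word_lists row_word_lists that, OF assms(1,2)]
    by (simp only: lds_row_word[OF assms(1)] lds_row_word[OF assms(2)])
  have bound: "\<Union>(set Ts) \<subseteq> {1..n}" if "n_tableau n Ts" for Ts
    using that by (induction Ts) auto
  show "height Rs x = height Ss x"
  proof (cases "x \<in> {1..n}")
    case True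
    then show ?thesis
      by (intro antisym height_le_of_greedy_eq[OF assms(1,2)] height_le_of_greedy_eq[OF assms(2,1)])
        (simp_all add: eq)
  next
    case False
    then have "x \<notin> \<Union>(set Rs)" "x \<notin> \<Union>(set Ss)" using bound assms by blast+
    then show ?thesis by (simp add: height_eq_0)
  qed
qed

lemma rho_eq_imp_stylic_cong:
  assumes "u \<in> lists {1..n}" "v \<in> lists {1..n}" "rho n u = rho n v"
  shows "(u, v) \<in> stylic_cong n"
proof -
  obtain Rs where Rs: "n_tableau n Rs" "(u, row_word Rs) \<in> stylic_cong n"
    using ex_n_tableau_stylic_cong[OF assms(1)] .
  obtain Ss where Ss: "n_tableau n Ss" "(v, row_word Ss) \<in> stylic_cong n"
    using ex_n_tableau_stylic_cong[OF assms(2)] .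
  have "rho n (row_word Rs) = rho n (row_word Ss)"
    using Rs(2) Ss(2) assms(3) by (simp add: rho_stylic_cong)
  then have "Rs = Ss" using Rs Ss row_word_eqI by blast
  with Rs Ss show ?thesis by (blast intro: stylic_cong.trans stylic_cong.sym)
qed

theorem theorem3p5:
  fixes n :: nat
  assumes "n \<ge> 1"
  shows "(\<forall>w \<in> lists {1..n}. varrho n (stylic_class n w) = rho n w)
    \<and> varrho n \<in> hom (styl n) (tropical_unitriangular (n + 1))
    \<and> varrho n \<one>\<^bsub>styl n\<^esub> = \<one>\<^bsub>tropical_unitriangular (n + 1)\<^esub>
    \<and> inj_on (varrho n) (carrier (styl n))"
proof (intro conjI ballI)
  show "varrho n (stylic_class n w) = rho n w" if "w \<in> lists {1..n}" for w
    using that by (rule varrho_stylic_class)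
  show "varrho n \<in> hom (styl n) (tropical_unitriangular (n + 1))"
  proof (rule homI)
    fix C assume "C \<in> carrier (styl n)"
    then obtain u where "C = stylic_class n u" "u \<in> lists {1..n}" unfolding carrier_styl by blast
    then show "varrho n C \<in> carrier (tropical_unitriangular (n + 1))"
      using rho_carrier by (simp only: varrho_stylic_class)
  next
    fix C D assume "C \<in> carrier (styl n)" "D \<in> carrier (styl n)"
    then obtain u v where "C = stylic_class n u" "u \<in> lists {1..n}"
      "D = stylic_class n v" "v \<in> lists {1..n}" unfolding carrier_styl by blast
    moreover from this have "u @ v \<in> lists {1..n}" by simp
    ultimately show "varrho n (C \<otimes>\<^bsub>styl n\<^esub> D) =
        varrho n C \<otimes>\<^bsub>tropical_unitriangular (n + 1)\<^esub> varrho n D"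
      by (simp only: mult_styl varrho_stylic_class rho_append)
        (simp add: tropical_unitriangular_def)
  qed
  \<comment> \<open>Membership in \<open>hom\<close> concerns products only, so the unit is treated
    through the empty word.\<close>
  have "varrho n (stylic_class n []) = rho n []" by (rule varrho_stylic_class) simp
  then show "varrho n \<one>\<^bsub>styl n\<^esub> = \<one>\<^bsub>tropical_unitriangular (n + 1)\<^esub>"
    by (simp add: styl_def tropical_unitriangular_def rho_def)
  show "inj_on (varrho n) (carrier (styl n))"
  proof (rule inj_onI)
    fix C D assume "C \<in> carrier (styl n)" "D \<in> carrier (styl n)"
      and eq: "varrho n C = varrho n D"
    then obtain u v where uv: "C = stylic_class n u" "u \<in> lists {1..n}"
      "D = stylic_class n v" "v \<in> lists {1..n}" unfolding carrier_styl by blast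
    then have "rho n u = rho n v" using eq by (simp only: varrho_stylic_class)
    then show "C = D" using uv rho_eq_imp_stylic_cong stylic_class_eq_iff by blast
  qed
qed

end
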